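(* Let $T$ be an ergodic measure-preserving map on the probability space $(X,\mathcal{A},\mu)$, $\theta\in(0,1]$, and $(A_l)_{l\ge 1}$ a sequence in $\mathcal{A}$ such that $0<\mu(A_l)\to 0$ and $A_l=A_l^{\bullet}\cup A_l^{\circ}$ (measurable and disjoint) with $$\mu_{A_l}(A_l^{\circ})\to\theta\qquad\text{and}\qquad \mu(A_l)\,\|1_{A_l^{\bullet}}\varphi_{A_l}\|_\infty\to 0\qquad\text{as } l\to\infty.$$ Suppose that the normalized hitting times converge to an exponential law, $$\mu\big(\mu(A_l)\,\varphi_{A_l}\le t\big)\Longrightarrow 1-e^{-\theta t}\qquad\text{as } l\to\infty.$$ (a) If for every sequence $(k_l)\in\mathcal{K}(A_l)$, $$\big|\mu_{A_l^{\circ}}(\varphi_{A_l}=k_l)-\mu(\varphi_{A_l}=k_l)\big|=o(\mu(A_l))\qquad\text{as } l\to\infty, \qquad( * )$$ then $(A_l)$ satisfies a local limit theorem for return times in that, for every $\delta\in(0,1]$, $$\mu_{A_l}(\varphi_{A_l}=k_l)\sim\theta^2 e^{-\theta\mu(A_l)k_l}\,\mu(A_l)\qquad\text{as } l\to\infty,\ \text{uniformly in } (k_l)\in\mathcal{K}_\delta(A_l).$$ (b) Condition $( * )$ (for every $(k_l)\in\mathcal{K}(A_l)$) is satisfied whenever there are integers $\tau_l\ge 0$ for which $\mu(A_l)\,\tau_l\to 0$ as $l\to\infty$, such that for all sequences $(k_l)\in\mathcal{K}(A_l)$, $$\big|\mu_{A_l^{\circ}}(T^{-\tau_l}\{\varphi_{A_l}=k_l\})-\mu(\varphi_{A_l}=k_l)\big|=o(\mu(A_l))\qquad\text{as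 } l\to\infty,$$ and $$\mu_{A_l^{\circ}}\big(\{\varphi_{A_l}\le\tau_l\}\cap T^{-k_l}A_l\big)=o(\mu(A_l))\qquad\text{as } l\to\infty.$$
   Context: For $A\in\mathcal{A}$ the hitting time function is $\varphi_A(x):=\inf\{n\ge 1: T^n x\in A\}\in\{1,2,\ldots,\infty\}$, $x\in X$; it is finite a.e. if $\mu(A)>0$. For $A\in\mathcal{A}$ with $\mu(A)>0$, $\mu_A(E):=\mu(A\cap E)/\mu(A)$. $\|\cdot\|_\infty$ is the $L_\infty(\mu)$-norm. $F_l(t)\Rightarrow F(t)$ means $F_l(t)\to F(t)$ at every continuity point $t$ of $F$. For $\delta\in(0,1]$, $\mathcal{K}_\delta(A_l):=\{(k_l)_{l\ge 1}: k_l\in\mathbb{N},\ \delta\le \mu(A_l)k_l\le\delta^{-1}\text{ for } l\ge 1\}$, and $\mathcal{K}(A_l):=\bigcup_{\delta\in(0,1]}\mathcal{K}_\delta(A_l)$. Uniformity of $a_l\sim b_l$ in $(k_l)\in\mathcal{K}_\delta(A_l)$ means: for every $\varepsilon>0$ there is $l_0$ such that $|a_l/b_l-1|<\varepsilon$ for all $l\ge l_0$ and all $(k_l)\in\mathcal{K}_\delta(A_l)$. *)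

theory Defs
  imports "HOL-Probability.Probability" "HOL-Library.Landau_Symbols"
begin

definition measure_preserving_map :: "'a measure \<Rightarrow> ('a \<Rightarrow> 'a) \<Rightarrow> bool" where
  "measure_preserving_map M T \<longleftrightarrow>
     T \<in> measurable M M \<and>
     (\<forall>E\<in>sets M. emeasure M (T -` E \<inter> space M) = emeasure M E)"

text \<open>Ergodicity is meant for probability spaces: invariant sets have measure zero or one.\<close>

definition ergodic_mpt :: "'a measure \<Rightarrow> ('a \<Rightarrow> 'a) \<Rightarrow> bool" where
  "ergodic_mpt M T \<longleftrightarrow>
     measure_preserving_map M T \<and>
     (\<forall>E\<in>sets M. T -` E \<inter> space M = E \<longrightarrow> measure M E = 0 \<or> measure M E = 1)"

text \<open>The infimum of the empty set in \<^typ>\<open>enat\<close> is \<open>\<infinity>\<close>.\<close>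

definition hitting_time :: "('a \<Rightarrow> 'a) \<Rightarrow> 'a set \<Rightarrow> 'a \<Rightarrow> enat" where
  "hitting_time T A x = Inf {enat n | n. n \<ge> 1 \<and> (T ^^ n) x \<in> A}"

text \<open>For measurable \<open>E\<close> and \<open>A\<close> of positive finite measure, this is \<open>\<mu>(A \<inter> E) / \<mu>(A)\<close>;
  see \<open>measure_uniform_measure\<close>.\<close>

abbreviation cond_measure :: "'a measure \<Rightarrow> 'a set \<Rightarrow> 'a set \<Rightarrow> real" where
  "cond_measure M A E \<equiv> measure (uniform_measure M A) E"

text \<open>Extended-real valued, since hitting times may be infinite and the norm may be infinite.\<close>

definition Linfty_norm :: "'a measure \<Rightarrow> ('a \<Rightarrow> ereal) \<Rightarrow> ereal" where
  "Linfty_norm M f = esssup M (\<lambda>x. \<bar>f x\<bar>)"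

text \<open>All sequences are indexed by \<open>l \<ge> 1\<close>; their values at \<open>l = 0\<close> are irrelevant.\<close>

definition K_delta :: "'a measure \<Rightarrow> (nat \<Rightarrow> 'a set) \<Rightarrow> real \<Rightarrow> (nat \<Rightarrow> nat) set" where
  "K_delta M A \<delta> = {k. \<forall>l\<ge>1. \<delta> \<le> measure M (A l) * real (k l) \<and>
                              measure M (A l) * real (k l) \<le> 1 / \<delta>}"

definition K_all :: "'a measure \<Rightarrow> (nat \<Rightarrow> 'a set) \<Rightarrow> (nat \<Rightarrow> nat) set" where
  "K_all M A = (\<Union>\<delta>\<in>{0<..1}. K_delta M A \<delta>)"

definition asymp_equiv_uniformly ::
  "(nat \<Rightarrow> nat) set \<Rightarrow> ((nat \<Rightarrow> nat) \<Rightarrow> nat \<Rightarrow> real) \<Rightarrow> ((nat \<Rightarrow> nat) \<Rightarrow> nat \<Rightarrow> real) \<Rightarrow> bool" where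
  "asymp_equiv_uniformly K a b \<longleftrightarrow>
     (\<forall>\<epsilon>>0. \<exists>l0. \<forall>l\<ge>l0. \<forall>k\<in>K. \<bar>a k l / b k l - 1\<bar> < \<epsilon>)"

definition hit_at :: "'a measure \<Rightarrow> ('a \<Rightarrow> 'a) \<Rightarrow> 'a set \<Rightarrow> nat \<Rightarrow> 'a set" where
  "hit_at M T A n = {x \<in> space M. hitting_time T A x = enat n}"

text \<open>Condition \<open>(*)\<close> for a single sequence \<open>k\<close>; \<open>B l\<close> plays the role of \<open>A l\<^sup>\<circ>\<close>.\<close>

definition star_condition ::
  "'a measure \<Rightarrow> ('a \<Rightarrow> 'a) \<Rightarrow> (nat \<Rightarrow> 'a set) \<Rightarrow> (nat \<Rightarrow> 'a set) \<Rightarrow> (nat \<Rightarrow> nat) \<Rightarrow> bool" where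
  "star_condition M T A B k \<longleftrightarrow>
     (\<lambda>l. \<bar>cond_measure M (B l) (hit_at M T (A l) (k l)) - measure M (hit_at M T (A l) (k l))\<bar>)
       \<in> o(\<lambda>l. measure M (A l))"

end

theory Submission
  imports Defs
begin

text \<open>
  Invariance of \<open>\<mu>\<close> gives \<open>\<mu>(\<phi>\<^sub>A = n + 1) = \<mu>(A \<inter> {\<phi>\<^sub>A > n})\<close>, so \<open>\<mu>(\<phi>\<^sub>A = n)\<close> is nonincreasing
  in \<open>n \<ge> 1\<close>. A monotone density argument therefore upgrades convergence of the hitting-time
  distributions to the local statement \<open>\<mu>(\<phi>\<^sub>A = k) / \<mu>(A) - \<theta> exp (- \<theta> \<mu>(A) k) \<rightarrow> 0\<close>. For (a), points of
  \<open>A\<^sup>\<bullet>\<close> return too early to matter, \<open>(*)\<close> transfers the local statement to \<open>A\<^sup>\<circ>\<close>, and the relative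
  mass of \<open>A\<^sup>\<circ>\<close> contributes the second factor \<open>\<theta>\<close>. For (b), the event \<open>{\<phi>\<^sub>A = \<tau> + k'}\<close> differs from
  \<open>T\<^sup>-\<^sup>\<tau> {\<phi>\<^sub>A = k'}\<close> only on \<open>{\<phi>\<^sub>A \<le> \<tau>} \<inter> T\<^sup>-\<^sup>k A\<close> with \<open>k = \<tau> + k'\<close>, and the local statement shows that
  \<open>\<mu>(\<phi>\<^sub>A = k')\<close> and \<open>\<mu>(\<phi>\<^sub>A = k)\<close> agree up to \<open>o(\<mu>(A))\<close>.
\<close>

section \<open>Hitting times in terms of visits\<close>

text \<open>\<open>enat\<close> is well-ordered, so the infimum of a nonempty set of visit times is
  attained; the empty set would give \<infinity>, which is no \<open>enat n\<close>.\<close>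

lemma hitting_time_eq_enat_iff:
  "hitting_time T A x = enat n \<longleftrightarrow>
    n \<ge> 1 \<and> (T ^^ n) x \<in> A \<and> (\<forall>j\<in>{1..<n}. (T ^^ j) x \<notin> A)" (is "?L \<longleftrightarrow> ?R")
proof -
  let ?S = "{enat n | n. n \<ge> 1 \<and> (T ^^ n) x \<in> A}"
  show ?thesis
  proof
    assume L: ?L
    have "?S \<noteq> {}"
    proof
      assume "?S = {}"
      then have "hitting_time T A x = \<infinity>" unfolding hitting_time_def by (simp only: Inf_empty top_enat_def)
      with L show False by simp
    qed
    then obtain y where "y \<in> ?S" by blast
    then have "Inf ?S \<in> ?S" by (rule wellorder_InfI)
    then have "enat n \<in> ?S" using L by (simp only: hitting_time_def)
    moreover have "(T ^^ j) x \<notin> A" if "j \<in> {1..<n}" for j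
    proof
      assume "(T ^^ j) x \<in> A"
      with that have "enat j \<in> ?S" by auto
      then have "hitting_time T A x \<le> enat j" unfolding hitting_time_def by (rule Inf_lower)
      with L that show False by simp
    qed
    ultimately show ?R by auto
  next
    assume R: ?R
    show ?L unfolding hitting_time_def
    proof (rule antisym)
      show "Inf ?S \<le> enat n" using R by (intro Inf_lower) auto
      show "enat n \<le> Inf ?S"
      proof (rule Inf_greatest)
        fix y assume "y \<in> ?S"
        then obtain j where j: "y = enat j" "j \<ge> 1" "(T ^^ j) x \<in> A" by blast
        with R have "j \<notin> {1..<n}" by blast
        with j show "enat n \<le> y" by simp
      qed
    qed
  qed
qed

lemma hitting_time_le_enat_iff:
  "hitting_time T A x \<le> enat n \<longleftrightarrow> (\<exists>j\<in>{1..n}. (T ^^ j) x \<in> A)" (is "?L \<longleftrightarrow> ?R")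
proof
  assume ?L
  then obtain m where "hitting_time T A x = enat m" "m \<le> n"
    using enat_ile[of "hitting_time T A x" n] by auto
  then show ?R by (auto simp: hitting_time_eq_enat_iff)
next
  assume ?R
  then obtain j where j: "j \<in> {1..n}" "(T ^^ j) x \<in> A" by auto
  then have "hitting_time T A x \<le> enat j"
    unfolding hitting_time_def by (intro Inf_lower) auto
  with j show ?L by (simp add: order.trans)
qed

text \<open>Turns the distribution function of the normalized time into one at an integer index. As
  \<open>t\<close> is nonnegative, \<open>nat\<close> does not distort the floor; for an infinite
  hitting time both sides fail because \<open>m\<close> is positive.\<close>

lemma scaled_hitting_time_le_iff:
  assumes "0 < m" "0 \<le> t"
  shows "ereal m * ereal_of_enat (hitting_time T A x) \<le> ereal t \<longleftrightarrow>
    hitting_time T A x \<le> enat (nat \<lfloor>t / m\<rfloor>)"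
proof (cases "hitting_time T A x")
  case (enat n)
  have "m * real n \<le> t \<longleftrightarrow> real n \<le> t / m" using assms by (simp add: field_simps)
  also have "\<dots> \<longleftrightarrow> n \<le> nat \<lfloor>t / m\<rfloor>" using assms by (simp add: le_nat_iff le_floor_iff)
  finally show ?thesis using enat by simp
qed (use assms in auto)

section \<open>Consequences of invariance for the hitting-time law\<close>

text \<open>This is the event that the hitting time exceeds \<open>n\<close>, written with finitely
  many visit conditions so that measurability and the effect of one application of \<open>T\<close>
  are easy to read off.\<close>

definition no_hit :: "'a measure \<Rightarrow> ('a \<Rightarrow> 'a) \<Rightarrow> 'a set \<Rightarrow> nat \<Rightarrow> 'a set" where
  "no_hit M T A n = {x \<in> space M. \<forall>j\<in>{1..n}. (T ^^ j) x \<notin> A}"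

lemma hit_at_0 [simp]: "hit_at M T A 0 = {}"
  by (auto simp: hit_at_def hitting_time_eq_enat_iff)

lemma hit_at_Suc: "hit_at M T A (Suc n) = no_hit M T A n - no_hit M T A (Suc n)"
  by (auto simp: hit_at_def no_hit_def hitting_time_eq_enat_iff atLeastLessThanSuc_atLeastAtMost
      atLeastAtMostSuc_conv)

lemma no_hit_Suc_subset: "no_hit M T A (Suc n) \<subseteq> no_hit M T A n"
  by (auto simp: no_hit_def)

lemma sets_no_hit [measurable]:
  assumes [measurable]: "T \<in> measurable M M" "A \<in> sets M"
  shows "no_hit M T A n \<in> sets M"
proof -
  have [measurable]: "(T ^^ j) \<in> measurable M M" for j by (rule measurable_compose_n) fact
  show ?thesis unfolding no_hit_def by measurable
qed

lemma sets_hit_at [measurable]: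
  assumes [measurable]: "T \<in> measurable M M" "A \<in> sets M"
  shows "hit_at M T A n \<in> sets M"
  by (cases n) (auto simp: hit_at_Suc)

lemma measure_preserving_map_measure:
  assumes "measure_preserving_map M T" "E \<in> sets M"
  shows "measure M (T -` E \<inter> space M) = measure M E"
  using assms by (simp add: measure_preserving_map_def measure_def)

context finite_measure
begin

text \<open>Avoiding \<open>A\<close> at times 1 to \<open>Suc n\<close> means that
  \<open>T x\<close> avoids \<open>A\<close> now and at times 1 to \<open>n\<close>. By invariance,
  passing from \<open>no_hit\<close> at \<open>n\<close> to \<open>no_hit\<close> at
  \<open>Suc n\<close> thus loses exactly the mass of
  \<open>A \<inter> no_hit M T A n\<close>.\<close>

lemma measure_hit_at_Suc:
  assumes T: "measure_preserving_map M T" and [measurable]: "A \<in> sets M"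
  shows "measure M (hit_at M T A (Suc n)) = measure M (A \<inter> no_hit M T A n)"
proof -
  have [measurable]: "T \<in> measurable M M" using T by (simp add: measure_preserving_map_def)
  have "(\<forall>j\<in>{1..Suc n}. (T ^^ j) x \<notin> A) \<longleftrightarrow> T x \<notin> A \<and> (\<forall>j\<in>{1..n}. (T ^^ j) (T x) \<notin> A)" for x
  proof -
    have "{1..Suc n} = insert 1 (Suc ` {1..n})"
      by auto
    then show ?thesis by (simp add: funpow_Suc_right del: image_Suc_atLeastAtMost funpow.simps)
  qed
  then have "no_hit M T A (Suc n) = T -` (no_hit M T A n - A) \<inter> space M"
    using measurable_space[of T M M] by (auto simp: no_hit_def)
  then have "measure M (no_hit M T A (Suc n)) = measure M (no_hit M T A n - A)"
    using measure_preserving_map_measure[OF T, of "no_hit M T A n - A"] by simp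
  also have "\<dots> = measure M (no_hit M T A n) - measure M (A \<inter> no_hit M T A n)"
    by (subst finite_measure_Diff') (auto simp: Int_commute)
  moreover have "measure M (hit_at M T A (Suc n))
      = measure M (no_hit M T A n) - measure M (no_hit M T A (Suc n))"
    unfolding hit_at_Suc by (intro finite_measure_Diff no_hit_Suc_subset) auto
  ultimately show ?thesis by simp
qed

text \<open>The sets \<open>A \<inter> no_hit M T A n\<close> shrink as \<open>n\<close> grows.
  Monotonicity starts at index 1, since \<open>hit_at\<close> is empty at 0.\<close>

lemma measure_hit_at_antimono:
  assumes T: "measure_preserving_map M T" and [measurable]: "A \<in> sets M" and "1 \<le> i" "i \<le> j"
  shows "measure M (hit_at M T A j) \<le> measure M (hit_at M T A i)"
proof -
  obtain a b where ab: "i = Suc a" "j = Suc b" "a \<le> b"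
    using assms by (metis Suc_le_D Suc_le_mono One_nat_def)
  have [measurable]: "T \<in> measurable M M" using T by (simp add: measure_preserving_map_def)
  have "no_hit M T A b \<subseteq> no_hit M T A a" using ab by (auto simp: no_hit_def)
  then show ?thesis
    unfolding ab measure_hit_at_Suc[OF T assms(2)] by (intro finite_measure_mono) auto
qed

text \<open>Disjoint decomposition by the value of the hitting time; it rewrites the distribution
  function as the partial sums that \<open>monotone_density\<close> takes as input.\<close>

lemma measure_hitting_time_le:
  assumes [measurable]: "T \<in> measurable M M" "A \<in> sets M"
  shows "measure M {x \<in> space M. hitting_time T A x \<le> enat n} = (\<Sum>j=1..n. measure M (hit_at M T A j))"
proof -
  have "{x \<in> space M. hitting_time T A x \<le> enat n} = (\<Union>j\<in>{1..n}. hit_at M T A j)"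
  proof safe
    fix x assume x: "x \<in> space M" "hitting_time T A x \<le> enat n"
    then obtain m where "hitting_time T A x = enat m" "m \<le> n"
      using enat_ile[of "hitting_time T A x" n] by auto
    with x show "x \<in> (\<Union>j\<in>{1..n}. hit_at M T A j)"
      by (auto simp: hit_at_def hitting_time_eq_enat_iff intro!: bexI[of _ m])
  qed (auto simp: hit_at_def)
  also have "measure M \<dots> = (\<Sum>j=1..n. measure M (hit_at M T A j))"
    by (intro finite_measure_finite_Union) (auto simp: disjoint_family_on_def, auto simp: hit_at_def)
  finally show ?thesis .
qed

end

section \<open>From convergence of distributions to convergence of densities\<close>

text \<open>By monotonicity, \<open>p l (k l)\<close> lies between the averages of
  \<open>p l\<close> over index windows on either side of \<open>k l\<close>. Rescaled by
  \<open>m l\<close>, these averages tend to difference quotients of \<open>F\<close>, which by the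
  mean value theorem are values of \<open>f\<close> near \<open>s\<close>; continuity of
  \<open>f\<close> at \<open>s\<close> closes the gap.\<close>

lemma monotone_density:
  fixes m :: "nat \<Rightarrow> real" and p :: "nat \<Rightarrow> nat \<Rightarrow> real" and k :: "nat \<Rightarrow> nat"
  assumes m: "m \<longlonglongrightarrow> 0" and m_pos: "\<forall>\<^sub>F l in sequentially. 0 < m l"
    and anti: "\<forall>\<^sub>F l in sequentially. \<forall>i j. 1 \<le> i \<longrightarrow> i \<le> j \<longrightarrow> p l j \<le> p l i"
    and lim: "\<And>t. 0 < t \<Longrightarrow> (\<lambda>l. \<Sum>n=1..nat \<lfloor>t / m l\<rfloor>. p l n) \<longlonglongrightarrow> F t"
    and nonneg: "\<And>l n. 0 \<le> p l n"
    and deriv: "\<And>t. 0 < t \<Longrightarrow> (F has_real_derivative f t) (at t)"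
    and cont: "isCont f s"
    and s: "0 < s" and k: "(\<lambda>l. m l * real (k l)) \<longlonglongrightarrow> s"
  shows "(\<lambda>l. p l (k l) / m l) \<longlonglongrightarrow> f s"
proof -
  have window: "(\<Sum>n=1..nat \<lfloor>b / m l\<rfloor>. p l n) - (\<Sum>n=1..nat \<lfloor>a / m l\<rfloor>. p l n)
      = (\<Sum>n\<in>{nat \<lfloor>a / m l\<rfloor><..nat \<lfloor>b / m l\<rfloor>}. p l n)"
    if "0 < m l" "0 < a" "a < b" for a b l
  proof -
    have le: "nat \<lfloor>a / m l\<rfloor> \<le> nat \<lfloor>b / m l\<rfloor>"
      using that by (intro nat_mono floor_mono divide_right_mono) auto
    then have "{1..nat \<lfloor>b / m l\<rfloor>} = {1..nat \<lfloor>a / m l\<rfloor>} \<union> {nat \<lfloor>a / m l\<rfloor><..nat \<lfloor>b / m l\<rfloor>}"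
      by auto
    then have "(\<Sum>n=1..nat \<lfloor>b / m l\<rfloor>. p l n)
        = (\<Sum>n=1..nat \<lfloor>a / m l\<rfloor>. p l n) + (\<Sum>n\<in>{nat \<lfloor>a / m l\<rfloor><..nat \<lfloor>b / m l\<rfloor>}. p l n)"
      by (simp only:) (rule sum.union_disjoint; auto)
    then show ?thesis by simp
  qed
  have quot: "\<exists>z. a < z \<and> z < b \<and> (F b - F a) / (b - a) = f z" if "0 < a" "a < b" for a b
    using MVT2[OF that(2), of F f] deriv that by (force simp: field_simps)
  \<comment> \<open>The term \<open>c * m l\<close> absorbs the rounding in the number of window
    indices, which is \<open>(b - a) / m l\<close> up to 1; \<open>c\<close> is taken as -1 for the
    upper bound and 1 for the lower.\<close>
  have limq: "(\<lambda>l. ((\<Sum>n=1..nat \<lfloor>b / m l\<rfloor>. p l n) - (\<Sum>n=1..nat \<lfloor>a / m l\<rfloor>. p l n)) / (b - a + c * m l))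
      \<longlonglongrightarrow> (F b - F a) / (b - a)" if "0 < a" "a < b" for a b c
  proof -
    have "(\<lambda>l. b - a + c * m l) \<longlonglongrightarrow> b - a + c * 0" by (intro tendsto_intros m)
    then show ?thesis using that by (intro tendsto_divide tendsto_diff lim) auto
  qed
  have near: "\<exists>d>0. d < s \<and> (\<forall>z. \<bar>z - s\<bar> < d \<longrightarrow> \<bar>f z - f s\<bar> < e)" if e: "0 < e" for e
  proof -
    obtain d where "d > 0" "\<forall>z. \<bar>z - s\<bar> < d \<longrightarrow> \<bar>f z - f s\<bar> < e"
      using cont e unfolding isCont_def LIM_def dist_real_def
      by (metis abs_0 diff_self)
    \<comment> \<open>A radius of at most \<open>s / 2\<close> keeps the windows inside the positive
      reals, where \<open>lim\<close> and \<open>deriv\<close> apply.\<close>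
    then show ?thesis using s by (intro exI[of _ "min d (s/2)"]) auto
  qed
  show ?thesis
  proof (rule order_tendstoI)
    fix u assume u: "f s < u"
    obtain d where d: "0 < d" "d < s" "\<And>z. \<bar>z - s\<bar> < d \<Longrightarrow> \<bar>f z - f s\<bar> < u - f s"
      using near[of "u - f s"] u by auto
    \<comment> \<open>a window just below \<open>s\<close>, on which \<open>p l\<close> is at least \<open>p l (k l)\<close>\<close>
    define a b where "a = s - d / 2" and "b = s - d / 4"
    have ab: "0 < a" "a < b" "b < s" using d by (auto simp: a_def b_def)
    obtain z where z: "a < z" "z < b" "(F b - F a) / (b - a) = f z" using quot ab by blast
    have "f z < u" using d(3)[of z] z d(1) by (auto simp: a_def b_def)
    with order_tendstoD(2)[OF limq[OF ab(1,2), of "-1"], of u] z(3)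
    have ev1: "\<forall>\<^sub>F l in sequentially. ((\<Sum>n=1..nat \<lfloor>b / m l\<rfloor>. p l n)
        - (\<Sum>n=1..nat \<lfloor>a / m l\<rfloor>. p l n)) / (b - a + (-1) * m l) < u" by auto
    have ev2: "\<forall>\<^sub>F l in sequentially. m l < b - a"
      using order_tendstoD(2)[OF m, of "b - a"] ab by auto
    have ev3: "\<forall>\<^sub>F l in sequentially. b < m l * real (k l)"
      using order_tendstoD(1)[OF k, of b] ab by auto
    show "\<forall>\<^sub>F l in sequentially. p l (k l) / m l < u"
      using ev1 ev2 ev3 m_pos anti
    proof eventually_elim
      case (elim l)
      let ?W = "{nat \<lfloor>a / m l\<rfloor><..nat \<lfloor>b / m l\<rfloor>}"
      have bk: "nat \<lfloor>b / m l\<rfloor> \<le> k l"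
      proof -
        have "b / m l < real (k l)" using elim by (simp add: field_simps)
        then show ?thesis by linarith
      qed
      have "real (nat \<lfloor>b / m l\<rfloor>) > b / m l - 1" "real (nat \<lfloor>a / m l\<rfloor>) \<le> a / m l"
        using ab elim by (auto simp: zero_le_floor)
      then have "(b - a - m l) / m l \<le> real (card ?W)"
        using elim by (simp add: diff_divide_distrib)
      then have "(b - a - m l) / m l * p l (k l) \<le> real (card ?W) * p l (k l)"
        by (intro mult_right_mono nonneg)
      also have "\<dots> = (\<Sum>n\<in>?W. p l (k l))" by simp
      also have "\<dots> \<le> (\<Sum>n\<in>?W. p l n)" using bk elim by (intro sum_mono) auto
      finally have "p l (k l) / m l * (b - a - m l) \<le> (\<Sum>n\<in>?W. p l n)" by (simp add: mult_ac)
      then have "p l (k l) / m l \<le> (\<Sum>n\<in>?W. p l n) / (b - a - m l)"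
        using elim by (subst pos_le_divide_eq) auto
      with elim window[of l a b] ab show ?case by simp
    qed
  next
    fix u assume u: "u < f s"
    obtain d where d: "0 < d" "d < s" "\<And>z. \<bar>z - s\<bar> < d \<Longrightarrow> \<bar>f z - f s\<bar> < f s - u"
      using near[of "f s - u"] u by auto
    \<comment> \<open>The mirror image: a window just above \<open>s\<close>, on which
      \<open>p l\<close> is at most \<open>p l (k l)\<close>.\<close>
    define a b where "a = s + d / 4" and "b = s + d / 2"
    have ab: "0 < a" "a < b" "s < a" using d s by (auto simp: a_def b_def)
    obtain z where z: "a < z" "z < b" "(F b - F a) / (b - a) = f z" using quot ab by blast
    have "u < f z" using d(3)[of z] z d(1) by (auto simp: a_def b_def)
    with order_tendstoD(1)[OF limq[OF ab(1,2), of 1], of u] z(3)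
    have ev1: "\<forall>\<^sub>F l in sequentially. u < ((\<Sum>n=1..nat \<lfloor>b / m l\<rfloor>. p l n)
        - (\<Sum>n=1..nat \<lfloor>a / m l\<rfloor>. p l n)) / (b - a + 1 * m l)" by auto
    have ev2: "\<forall>\<^sub>F l in sequentially. m l * real (k l) < a"
      using order_tendstoD(2)[OF k, of a] ab by auto
    have ev3: "\<forall>\<^sub>F l in sequentially. 0 < m l * real (k l)"
      using order_tendstoD(1)[OF k, of 0] s by auto
    show "\<forall>\<^sub>F l in sequentially. u < p l (k l) / m l"
      using ev1 ev2 ev3 m_pos anti
    proof eventually_elim
      case (elim l)
      let ?W = "{nat \<lfloor>a / m l\<rfloor><..nat \<lfloor>b / m l\<rfloor>}"
      \<comment> \<open>Index 0 must be excluded because \<open>anti\<close> compares only indices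
        from 1 on.\<close>
      have k1: "1 \<le> k l" using elim by (cases "k l") auto
      have ak: "k l \<le> nat \<lfloor>a / m l\<rfloor>"
      proof -
        have "real (k l) < a / m l" using elim by (simp add: field_simps)
        then show ?thesis by (simp add: le_nat_floor)
      qed
      have floors: "real (nat \<lfloor>b / m l\<rfloor>) \<le> b / m l" "real (nat \<lfloor>a / m l\<rfloor>) > a / m l - 1"
        using ab elim(4) by (auto simp: zero_le_floor)
      \<comment> \<open>An upper bound on the cardinality needs the exact difference, so truncated
        subtraction has to be ruled out here.\<close>
      have "nat \<lfloor>a / m l\<rfloor> \<le> nat \<lfloor>b / m l\<rfloor>"
        using ab elim(4) by (intro nat_mono floor_mono divide_right_mono) auto
      then have "real (card ?W) = real (nat \<lfloor>b / m l\<rfloor>) - real (nat \<lfloor>a / m l\<rfloor>)"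
        by (simp only: card_greaterThanAtMost of_nat_diff)
      moreover have "(b - a + m l) / m l = b / m l - a / m l + 1"
        using elim(4) by (simp add: diff_divide_distrib add_divide_distrib)
      ultimately have "real (card ?W) \<le> (b - a + m l) / m l"
        using floors by linarith
      then have "real (card ?W) * p l (k l) \<le> (b - a + m l) / m l * p l (k l)"
        by (intro mult_right_mono nonneg)
      moreover have "real (card ?W) * p l (k l) = (\<Sum>n\<in>?W. p l (k l))" by simp
      moreover have "(\<Sum>n\<in>?W. p l n) \<le> (\<Sum>n\<in>?W. p l (k l))"
        using ak k1 elim by (intro sum_mono) auto
      ultimately have "(\<Sum>n\<in>?W. p l n) \<le> p l (k l) / m l * (b - a + m l)" by (simp add: mult_ac)
      then have "(\<Sum>n\<in>?W. p l n) / (b - a + m l) \<le> p l (k l) / m l"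
        using elim ab by (subst pos_divide_le_eq) auto
      with elim window[of l a b] ab show ?case by simp
    qed
  qed
qed


section \<open>Local asymptotics of the hitting-time law\<close>

text \<open>The products of \<open>measure M (A l)\<close> and \<open>k l\<close> need not converge,
  but they stay in a compact interval. If the claim failed, some subsequence would stay bad while
  these products converge along it, contradicting \<open>monotone_density\<close>.\<close>

lemma measure_hit_at_asymp:
  assumes "finite_measure M" and T: "measure_preserving_map M T" and \<theta>: "0 < \<theta>"
    and A: "\<And>l. l \<ge> 1 \<Longrightarrow> A l \<in> sets M"
    and pos: "\<And>l. l \<ge> 1 \<Longrightarrow> 0 < measure M (A l)"
    and null: "(\<lambda>l. measure M (A l)) \<longlonglongrightarrow> 0"
    and wc: "weak_conv
           (\<lambda>l t. measure M {x \<in> space M.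
              ereal (measure M (A l)) * ereal_of_enat (hitting_time T (A l) x) \<le> ereal t})
           (\<lambda>t. if t < 0 then 0 else 1 - exp (- \<theta> * t))"
    and \<delta>: "0 < \<delta>" and k: "k \<in> K_delta M A \<delta>"
  shows "(\<lambda>l. measure M (hit_at M T (A l) (k l)) / measure M (A l)
            - \<theta> * exp (- \<theta> * measure M (A l) * real (k l))) \<longlonglongrightarrow> 0" (is "?h \<longlonglongrightarrow> 0")
proof (rule ccontr)
  interpret finite_measure M by fact
  have Tm: "T \<in> measurable M M" using T by (simp add: measure_preserving_map_def)
  define m where "m l = measure M (A l)" for l
  define p where "p l n = measure M (hit_at M T (A l) n)" for l n
  have lim: "(\<lambda>l. \<Sum>n=1..nat \<lfloor>t / m l\<rfloor>. p l n) \<longlonglongrightarrow> 1 - exp (- \<theta> * t)" if t: "0 < t" for t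
  proof -
    \<comment> \<open>\<open>weak_conv\<close> speaks only of continuity points; near a positive
      \<open>t\<close> the piecewise limit law agrees with its smooth branch.\<close>
    have "\<forall>\<^sub>F u in nhds t. 0 < u" using eventually_nhds_in_open[of "{0<..}" t] t by auto
    then have "\<forall>\<^sub>F u in nhds t. (if u < 0 then 0 else 1 - exp (- \<theta> * u)) = 1 - exp (- \<theta> * u)"
      by eventually_elim auto
    then have "isCont (\<lambda>t. if t < 0 then 0 else 1 - exp (- \<theta> * t)) t"
      by (subst isCont_cong) (auto intro!: continuous_intros)
    with wc t have "(\<lambda>l. measure M {x \<in> space M.
              ereal (m l) * ereal_of_enat (hitting_time T (A l) x) \<le> ereal t})
        \<longlonglongrightarrow> 1 - exp (- \<theta> * t)"
      unfolding weak_conv_def m_def by (auto dest: spec[of _ t])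
    moreover have "\<forall>\<^sub>F l in sequentially. measure M {x \<in> space M.
              ereal (m l) * ereal_of_enat (hitting_time T (A l) x) \<le> ereal t}
        = (\<Sum>n=1..nat \<lfloor>t / m l\<rfloor>. p l n)"
      using eventually_ge_at_top[of 1]
    proof eventually_elim
      case (elim l)
      then show ?case
        using pos[OF elim] t measure_hitting_time_le[OF Tm A[OF elim]]
        by (simp add: scaled_hitting_time_le_iff m_def p_def)
    qed
    ultimately show ?thesis by (rule Lim_transform_eventually)
  qed
  assume "\<not> ?h \<longlonglongrightarrow> 0"
  then obtain e where e: "0 < e" "\<not> (\<forall>\<^sub>F l in sequentially. dist (?h l) 0 < e)"
    unfolding tendsto_iff by blast
  obtain r :: "nat \<Rightarrow> nat" where r: "strict_mono r" "\<And>n. \<not> dist (?h (r n)) 0 < e"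
    using not_eventually_sequentiallyD[OF e(2)] by blast
  \<comment> \<open>Shifting the subsequence by one avoids the index 0, about which the hypotheses
    say nothing.\<close>
  have r1: "1 \<le> r (Suc n)" for n using strict_mono_imp_increasing[OF r(1), of "Suc n"] by simp
  have "\<forall>n. m (r (Suc n)) * real (k (r (Suc n))) \<in> {\<delta>..1 / \<delta>}"
    using k r1 unfolding K_delta_def m_def by auto
  then obtain c s where c: "c \<in> {\<delta>..1 / \<delta>}" and s: "strict_mono s"
    and xc: "((\<lambda>n. m (r (Suc n)) * real (k (r (Suc n)))) \<circ> s) \<longlonglongrightarrow> c"
    by (rule seq_compactE[OF compact_imp_seq_compact[OF compact_Icc]])
  define q where "q n = r (Suc (s n))" for n
  have q: "strict_mono q"
    using r(1) s by (simp add: strict_mono_def q_def)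
  have q1: "1 \<le> q n" for n by (simp only: q_def r1)
  have xq: "(\<lambda>n. m (q n) * real (k (q n))) \<longlonglongrightarrow> c" using xc by (simp add: q_def o_def)
  have "(\<lambda>n. p (q n) (k (q n)) / m (q n)) \<longlonglongrightarrow> \<theta> * exp (- \<theta> * c)"
  proof (rule monotone_density[where m = "\<lambda>n. m (q n)" and p = "\<lambda>n. p (q n)" and k = "\<lambda>n. k (q n)"
        and F = "\<lambda>t. 1 - exp (- \<theta> * t)" and f = "\<lambda>t. \<theta> * exp (- \<theta> * t)"])
    show "(\<lambda>n. m (q n)) \<longlonglongrightarrow> 0"
      using LIMSEQ_subseq_LIMSEQ[OF null q] by (simp add: o_def m_def)
    show "\<forall>\<^sub>F n in sequentially. 0 < m (q n)" using pos q1 by (simp add: m_def)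
    show "\<forall>\<^sub>F n in sequentially. \<forall>i j. 1 \<le> i \<longrightarrow> i \<le> j \<longrightarrow> p (q n) j \<le> p (q n) i"
      unfolding p_def using measure_hit_at_antimono[OF T A[OF q1]] by (intro always_eventually) blast
    show "(\<lambda>n. \<Sum>i=1..nat \<lfloor>t / m (q n)\<rfloor>. p (q n) i) \<longlonglongrightarrow> 1 - exp (- \<theta> * t)" if "0 < t" for t
      using LIMSEQ_subseq_LIMSEQ[OF lim[OF that] q] by (simp add: o_def)
    show "((\<lambda>t. 1 - exp (- \<theta> * t)) has_real_derivative \<theta> * exp (- \<theta> * t)) (at t)" for t
      by (auto intro!: derivative_eq_intros)
  qed (use c \<delta> xq in \<open>auto simp: p_def intro!: continuous_intros\<close>)
  moreover have "(\<lambda>n. \<theta> * exp (- \<theta> * (m (q n) * real (k (q n))))) \<longlonglongrightarrow> \<theta> * exp (- \<theta> * c)"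
    by (intro tendsto_intros xq)
  ultimately have "(\<lambda>n. p (q n) (k (q n)) / m (q n) - \<theta> * exp (- \<theta> * (m (q n) * real (k (q n))))) \<longlonglongrightarrow> 0"
    using tendsto_diff by fastforce
  then have "(\<lambda>n. ?h (q n)) \<longlonglongrightarrow> 0" by (simp add: p_def m_def mult.assoc)
  then have "\<forall>\<^sub>F n in sequentially. dist (?h (q n)) 0 < e" using e(1) by (rule tendstoD)
  then show False using r(2) by (auto simp: q_def eventually_sequentially)
qed

text \<open>Membership in \<^const>\<open>K_delta\<close> is a condition on each entry separately, so the worst entries of a family
  of sequences can be assembled into one sequence of the class.\<close>

lemma asymp_equiv_uniformly_K_deltaI:
  assumes lim: "\<And>k. k \<in> K_delta M A \<delta> \<Longrightarrow> (\<lambda>l. a (k l) l / b (k l) l) \<longlonglongrightarrow> 1"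
  shows "asymp_equiv_uniformly (K_delta M A \<delta>) (\<lambda>k l. a (k l) l) (\<lambda>k l. b (k l) l)"
  unfolding asymp_equiv_uniformly_def
proof (rule ccontr, goal_cases)
  case 1
  then obtain e where e: "0 < e"
    and bad: "\<And>l0. \<exists>l\<ge>l0. \<exists>k\<in>K_delta M A \<delta>. \<not> \<bar>a (k l) l / b (k l) l - 1\<bar> < e" by blast
  obtain k0 where k0: "k0 \<in> K_delta M A \<delta>" using bad by blast
  \<comment> \<open>At each \<open>l\<close> a sequence violating the bound there is chosen if one
    exists; otherwise \<open>k0\<close> serves as a filler.\<close>
  have "\<forall>l. \<exists>k\<in>K_delta M A \<delta>. (\<exists>k\<in>K_delta M A \<delta>. \<not> \<bar>a (k l) l / b (k l) l - 1\<bar> < e)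
      \<longrightarrow> \<not> \<bar>a (k l) l / b (k l) l - 1\<bar> < e"
    using k0 by blast
  then obtain \<kappa> where \<kappa>: "\<And>l. \<kappa> l \<in> K_delta M A \<delta>"
    "\<And>l k. k \<in> K_delta M A \<delta> \<Longrightarrow> \<not> \<bar>a (k l) l / b (k l) l - 1\<bar> < e
      \<Longrightarrow> \<not> \<bar>a (\<kappa> l l) l / b (\<kappa> l l) l - 1\<bar> < e"
    by metis
  have "(\<lambda>l. \<kappa> l l) \<in> K_delta M A \<delta>" using \<kappa>(1) by (auto simp: K_delta_def)
  from tendstoD[OF lim[OF this] e] obtain l0
    where "\<And>l. l \<ge> l0 \<Longrightarrow> \<bar>a (\<kappa> l l) l / b (\<kappa> l l) l - 1\<bar> < e"
    by (auto simp: eventually_sequentially dist_real_def)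
  with bad[of l0] \<kappa>(2) show False by blast
qed

section \<open>Time shifts and points that return early\<close>

text \<open>The preimage under \<open>T ^^ \<tau>\<close> ignores visits at times 1 to
  \<open>\<tau>\<close>. It therefore contains the first-hit event, and any surplus point has
  visited \<open>A\<close> by time \<open>\<tau>\<close> and lies in \<open>A\<close> at time
  \<open>\<tau> + n\<close>. The lemma asks only for a measurable \<open>T\<close>, so that it
  applies to conditional measures, which \<open>T\<close> may fail to preserve.\<close>

lemma (in finite_measure) measure_hit_at_add:
  assumes [measurable]: "T \<in> measurable M M" "A \<in> sets M" and n: "1 \<le> n"
  shows "\<bar>measure M (hit_at M T A (\<tau> + n)) - measure M ((T ^^ \<tau>) -` hit_at M T A n \<inter> space M)\<bar>
    \<le> measure M ({x \<in> space M. hitting_time T A x \<le> enat \<tau>} \<inter> ((T ^^ (\<tau> + n)) -` A \<inter> space M))"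
    (is "\<bar>measure M ?H - measure M ?P\<bar> \<le> measure M ?E")
proof -
  have Tj [measurable]: "(T ^^ j) \<in> measurable M M" for j by (rule measurable_compose_n) fact
  have add: "(T ^^ j) ((T ^^ \<tau>) x) = (T ^^ (\<tau> + j)) x" for j x
    by (simp add: funpow_add[symmetric, THEN fun_cong, unfolded o_def] add.commute)
  have "{x \<in> space M. hitting_time T A x \<le> enat \<tau>} \<in> sets M"
    unfolding hitting_time_le_enat_iff by measurable
  then have [measurable]: "?E \<in> sets M" by measurable
  have [measurable]: "?P \<in> sets M" "?H \<in> sets M" by measurable
  have "?H \<subseteq> ?P"
    using n measurable_space[OF Tj] by (auto simp: hit_at_def hitting_time_eq_enat_iff add)
  then have "measure M ?H \<le> measure M ?P" by (intro finite_measure_mono) auto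
  have "?P \<subseteq> ?H \<union> ?E"
  proof
    fix x assume x: "x \<in> ?P"
    have "(T ^^ j) x \<notin> A" if "\<not> hitting_time T A x \<le> enat \<tau>" "1 \<le> j" "j < \<tau> + n" for j
    proof (cases "j \<le> \<tau>")
      case False
      then have "j - \<tau> \<in> {1..<n}" using that by auto
      then have "(T ^^ (j - \<tau>)) ((T ^^ \<tau>) x) \<notin> A"
        using x by (auto simp: hit_at_def hitting_time_eq_enat_iff)
      with False show ?thesis by (simp add: add)
    qed (use that in \<open>auto simp: hitting_time_le_enat_iff\<close>)
    with x n show "x \<in> ?H \<union> ?E"
      by (auto simp: hit_at_def hitting_time_eq_enat_iff add)
  qed
  then have "measure M ?P \<le> measure M (?H \<union> ?E)" by (intro finite_measure_mono) auto
  also have "\<dots> \<le> measure M ?H + measure M ?E" by (intro measure_Un_le) auto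
  finally show ?thesis using \<open>measure M ?H \<le> measure M ?P\<close> by linarith
qed

lemma hit_at_uniform_measure [simp]: "hit_at (uniform_measure M B) T A n = hit_at M T A n"
  by (simp add: hit_at_def)

text \<open>On this set the function under the norm equals \<open>k\<close>, and
  \<open>m * real k\<close> is at least \<open>\<delta>\<close>, whereas almost everywhere the
  scaled function stays below \<open>\<delta>\<close>.\<close>

lemma measure_hit_at_inter_eq_0:
  assumes "finite_measure M" and [measurable]: "T \<in> measurable M M" "A \<in> sets M" "B \<in> sets M"
    and small: "ereal m * Linfty_norm M (\<lambda>x. indicator B x * ereal_of_enat (hitting_time T A x)) < ereal \<delta>"
    and m: "0 \<le> m" and k: "\<delta> \<le> m * real k"
  shows "measure M (B \<inter> hit_at M T A k) = 0"
proof -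
  interpret finite_measure M by fact
  have "AE x in M. \<bar>indicator B x * ereal_of_enat (hitting_time T A x)\<bar>
      \<le> Linfty_norm M (\<lambda>x. indicator B x * ereal_of_enat (hitting_time T A x))"
    unfolding Linfty_norm_def by (rule esssup_AE)
  then have "AE x in M. x \<notin> B \<inter> hit_at M T A k"
  proof eventually_elim
    case (elim x)
    show ?case
    proof
      assume x: "x \<in> B \<inter> hit_at M T A k"
      have "ereal m * ereal (real k) \<le> ereal m * Linfty_norm M (\<lambda>x. indicator B x * ereal_of_enat (hitting_time T A x))"
        using elim x m by (intro ereal_mult_left_mono) (auto simp: hit_at_def)
      with small k show False by (metis ereal_less_eq(3) leD order.trans times_ereal.simps(1))
    qed
  qed
  then have "B \<inter> hit_at M T A k \<in> null_sets M" by (subst AE_iff_null_sets) auto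
  then show ?thesis by (simp add: measure_eq_0_null_sets)
qed

section \<open>The local limit theorem for returns and the sufficient condition for it\<close>

theorem theorem2p3:
  fixes M :: "'a measure" and T :: "'a \<Rightarrow> 'a" and \<theta> :: real
    and A Abul Acirc :: "nat \<Rightarrow> 'a set"
  assumes "prob_space M"
    and "ergodic_mpt M T"
    and "0 < \<theta>" and "\<theta> \<le> 1"
    and "\<And>l. l \<ge> 1 \<Longrightarrow> A l \<in> sets M"
    and "\<And>l. l \<ge> 1 \<Longrightarrow> 0 < measure M (A l)"
    and "(\<lambda>l. measure M (A l)) \<longlonglongrightarrow> 0"
    and "\<And>l. l \<ge> 1 \<Longrightarrow> Abul l \<in> sets M"
    and "\<And>l. l \<ge> 1 \<Longrightarrow> Acirc l \<in> sets M"
    and "\<And>l. l \<ge> 1 \<Longrightarrow> A l = Abul l \<union> Acirc l"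
    and "\<And>l. l \<ge> 1 \<Longrightarrow> Abul l \<inter> Acirc l = {}"
    and "(\<lambda>l. cond_measure M (A l) (Acirc l)) \<longlonglongrightarrow> \<theta>"
    and "(\<lambda>l. ereal (measure M (A l)) *
            Linfty_norm M (\<lambda>x. indicator (Abul l) x * ereal_of_enat (hitting_time T (A l) x)))
          \<longlonglongrightarrow> 0"
    and "weak_conv
           (\<lambda>l t. measure M {x \<in> space M.
              ereal (measure M (A l)) * ereal_of_enat (hitting_time T (A l) x) \<le> ereal t})
           (\<lambda>t. if t < 0 then 0 else 1 - exp (- \<theta> * t))"
  shows
    "((\<forall>k\<in>K_all M A. star_condition M T A Acirc k) \<longrightarrow>
     (\<forall>\<delta>\<in>{0<..1}.
        asymp_equiv_uniformly (K_delta M A \<delta>)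
          (\<lambda>k l. cond_measure M (A l) (hit_at M T (A l) (k l)))
          (\<lambda>k l. \<theta>\<^sup>2 * exp (- \<theta> * measure M (A l) * real (k l)) * measure M (A l)))) \<and>
     ((\<exists>\<tau> :: nat \<Rightarrow> nat.
        (\<lambda>l. measure M (A l) * real (\<tau> l)) \<longlonglongrightarrow> 0 \<and>
        (\<forall>k\<in>K_all M A.
           (\<lambda>l. \<bar>cond_measure M (Acirc l) ((T ^^ \<tau> l) -` hit_at M T (A l) (k l) \<inter> space M)
                 - measure M (hit_at M T (A l) (k l))\<bar>)
             \<in> o(\<lambda>l. measure M (A l))) \<and>
        (\<forall>k\<in>K_all M A.
           (\<lambda>l. cond_measure M (Acirc l)
                  ({x \<in> space M. hitting_time T (A l) x \<le> enat (\<tau> l)}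
                   \<inter> ((T ^^ k l) -` A l \<inter> space M)))
             \<in> o(\<lambda>l. measure M (A l)))) \<longrightarrow>
     (\<forall>k\<in>K_all M A. star_condition M T A Acirc k))"
proof -
  interpret prob_space M by fact
  note A = assms(5) and A_pos = assms(6) and A_null = assms(7) and Abul = assms(8) and Acirc = assms(9)
  have T: "measure_preserving_map M T" using assms(2) by (simp add: ergodic_mpt_def)
  then have Tm [measurable]: "T \<in> measurable M M" by (simp add: measure_preserving_map_def)
  define m where "m l = measure M (A l)" for l
  define c where "c l = cond_measure M (A l) (Acirc l)" for l
  have m0: "m \<longlonglongrightarrow> 0" using A_null by (simp add: m_def[abs_def])
  have c_lim: "c \<longlonglongrightarrow> \<theta>" using assms(12) by (simp add: c_def[abs_def])
  have ev1: "\<forall>\<^sub>F l in sequentially. 1 \<le> (l::nat)" by (rule eventually_ge_at_top)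
  have m_pos: "0 < m l" if "1 \<le> l" for l using A_pos[OF that] by (simp add: m_def)
  have m_nz: "\<forall>\<^sub>F l in sequentially. m l \<noteq> 0" using ev1 by eventually_elim (use m_pos in force)
  have cond_A: "cond_measure M (A l) E = measure M (A l \<inter> E) / m l"
    if "1 \<le> l" "E \<in> sets M" for l E
    using A_pos[OF that(1)] A[OF that(1)] that(2) by (simp add: measure_uniform_measure emeasure_eq_measure m_def)
  \<comment> \<open>Since \<open>\<theta>\<close> is positive, \<open>Acirc l\<close> eventually has
    positive mass, so conditioning on it is a genuine quotient.\<close>
  have Acirc_pos: "\<forall>\<^sub>F l in sequentially. 0 < measure M (Acirc l)"
    using order_tendstoD(1)[OF c_lim assms(3)] ev1
  proof eventually_elim
    case (elim l)
    have "A l \<inter> Acirc l = Acirc l" using assms(10)[OF elim(2)] by auto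
    with elim cond_A[OF elim(2) Acirc[OF elim(2)]] m_pos[OF elim(2)] show ?case
      by (simp add: c_def zero_less_divide_iff)
  qed
  have hit_lim: "(\<lambda>l. measure M (hit_at M T (A l) (k l)) / m l - \<theta> * exp (- \<theta> * m l * real (k l))) \<longlonglongrightarrow> 0"
    if "k \<in> K_delta M A \<delta>" "0 < \<delta>" for k \<delta>
    unfolding m_def
    by (rule measure_hit_at_asymp[OF _ T assms(3) A A_pos A_null assms(14) that(2,1)]) unfold_locales
  \<comment> \<open>The upper bound controls products with vanishing factors; the lower one, free of
    \<open>l\<close>, turns additive errors into relative ones.\<close>
  have exp_bounds: "\<theta> * exp (- \<theta> * m l * real (k l)) \<le> \<theta>"
      "\<theta> * exp (- (\<theta> / \<delta>)) \<le> \<theta> * exp (- \<theta> * m l * real (k l))"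
    if "k \<in> K_delta M A \<delta>" "0 < \<delta>" "1 \<le> l" for k \<delta> l
  proof -
    have x: "0 \<le> m l * real (k l)" "m l * real (k l) \<le> 1 / \<delta>"
      using that m_pos[OF that(3)] by (auto simp: K_delta_def m_def)
    show "\<theta> * exp (- \<theta> * m l * real (k l)) \<le> \<theta>"
      using x(1) assms(3) by (simp add: mult.assoc)
    have "\<theta> * (m l * real (k l)) \<le> \<theta> * (1 / \<delta>)" using x(2) assms(3) by (intro mult_left_mono) auto
    then show "\<theta> * exp (- (\<theta> / \<delta>)) \<le> \<theta> * exp (- \<theta> * m l * real (k l))"
      using assms(3) by (simp add: mult.assoc)
  qed

  \<comment> \<open>Return times to \<open>A l\<close> under the hypothesis on
    \<open>Acirc l\<close>\<close>
  have part_a: "(\<lambda>l. cond_measure M (A l) (hit_at M T (A l) (k l))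
      / (\<theta>\<^sup>2 * exp (- \<theta> * measure M (A l) * real (k l)) * measure M (A l))) \<longlonglongrightarrow> 1"
    if star: "star_condition M T A Acirc k" and k: "k \<in> K_delta M A \<delta>" and \<delta>: "0 < \<delta>" for k \<delta>
  proof -
    define h where "h l = hit_at M T (A l) (k l)" for l
    define e where "e l = \<theta> * exp (- \<theta> * m l * real (k l))" for l
    define q where "q l = cond_measure M (Acirc l) (h l) / m l" for l
    have h: "h l \<in> sets M" if "1 \<le> l" for l using A[OF that] by (simp add: h_def)
    have "(\<lambda>l. \<bar>cond_measure M (Acirc l) (h l) - measure M (h l)\<bar> / m l) \<longlonglongrightarrow> 0"
      using star unfolding star_condition_def m_def h_def by (rule smalloD_tendsto)
    then have "(\<lambda>l. \<bar>(cond_measure M (Acirc l) (h l) - measure M (h l)) / m l\<bar>) \<longlonglongrightarrow> 0"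
      by (simp add: m_def)
    then have "(\<lambda>l. q l - measure M (h l) / m l) \<longlonglongrightarrow> 0"
      unfolding q_def diff_divide_distrib by (simp only: tendsto_rabs_zero_iff)
    from tendsto_add[OF this hit_lim[OF k \<delta>]] have qe: "(\<lambda>l. q l - e l) \<longlonglongrightarrow> 0"
      by (simp add: e_def h_def)
    have bul: "\<forall>\<^sub>F l in sequentially. ereal (m l) *
        Linfty_norm M (\<lambda>x. indicator (Abul l) x * ereal_of_enat (hitting_time T (A l) x)) < ereal \<delta>"
      using order_tendstoD(2)[OF assms(13), of "ereal \<delta>"] \<delta> by (simp add: m_def)
    \<comment> \<open>\<open>Abul l\<close> meets the event in a null set, so only
      \<open>Acirc l\<close> contributes: its relative mass \<open>c l\<close> times the scaled
      conditional probability \<open>q l\<close>.\<close>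
    have split: "\<forall>\<^sub>F l in sequentially. cond_measure M (A l) (h l) / m l = c l * q l"
      using bul ev1 Acirc_pos
    proof eventually_elim
      case (elim l)
      note l = elim(2)
      have [measurable]: "h l \<in> sets M" "Abul l \<in> sets M" "Acirc l \<in> sets M"
        using h[OF l] Abul[OF l] Acirc[OF l] by auto
      have "measure M (Abul l \<inter> h l) = 0"
        unfolding h_def
        by (rule measure_hit_at_inter_eq_0[OF finite_measure_axioms Tm A[OF l] Abul[OF l] elim(1)])
          (use k l m_pos[OF l] in \<open>auto simp: K_delta_def m_def\<close>)
      moreover have "measure M (A l \<inter> h l) = measure M (Abul l \<inter> h l) + measure M (Acirc l \<inter> h l)"
        unfolding assms(10)[OF l] Int_Un_distrib2 using assms(11)[OF l]
        by (intro finite_measure_Union) auto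
      moreover have "A l \<inter> Acirc l = Acirc l" using assms(10)[OF l] by auto
      moreover have "cond_measure M (Acirc l) (h l) = measure M (Acirc l \<inter> h l) / measure M (Acirc l)"
        using elim(3) by (simp add: measure_uniform_measure emeasure_eq_measure)
      ultimately show ?case
        using elim(3) m_pos[OF l] by (simp add: c_def q_def cond_A[OF l] field_simps)
    qed
    have e_bd: "\<forall>\<^sub>F l in sequentially. norm (e l) \<le> \<theta>"
      using ev1 by eventually_elim (use exp_bounds[OF k \<delta>] assms(3) in \<open>auto simp: e_def\<close>)
    \<comment> \<open>This sum equals \<open>c l * q l - \<theta> * e l\<close>, split so that each
      summand has one vanishing and one bounded factor.\<close>
    have "(\<lambda>l. c l * (q l - e l) + (c l - \<theta>) * e l) \<longlonglongrightarrow> 0"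
    proof -
      have "\<forall>\<^sub>F l in sequentially. norm ((c l - \<theta>) * e l) \<le> \<bar>c l - \<theta>\<bar> * \<theta>"
        using e_bd by eventually_elim (auto simp: abs_mult intro!: mult_left_mono)
      moreover have "(\<lambda>l. \<bar>c l - \<theta>\<bar> * \<theta>) \<longlonglongrightarrow> 0"
        using c_lim by (intro tendsto_mult_left_zero tendsto_rabs_zero) (simp add: LIM_zero)
      ultimately have "(\<lambda>l. (c l - \<theta>) * e l) \<longlonglongrightarrow> 0" by (rule Lim_null_comparison)
      from tendsto_add[OF tendsto_mult[OF c_lim qe] this] show ?thesis by simp
    qed
    then have "(\<lambda>l. c l * q l - \<theta> * e l) \<longlonglongrightarrow> 0" by (simp add: algebra_simps)
    then have "(\<lambda>l. cond_measure M (A l) (h l) / m l - \<theta> * e l) \<longlonglongrightarrow> 0"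
      by (rule Lim_transform_eventually) (use split in eventually_elim, simp)
    \<comment> \<open>The denominator is the constant lower bound for \<open>\<theta> * e l\<close>
      supplied by \<open>exp_bounds\<close>, so dividing preserves the limit 0.\<close>
    then have lim: "(\<lambda>l. \<bar>cond_measure M (A l) (h l) / m l - \<theta> * e l\<bar> / (\<theta> * (\<theta> * exp (- (\<theta> / \<delta>))))) \<longlonglongrightarrow> 0"
      by (intro tendsto_divide_zero tendsto_rabs_zero)
    have "\<forall>\<^sub>F l in sequentially. norm (cond_measure M (A l) (h l) / (\<theta> * e l * m l) - 1)
        \<le> \<bar>cond_measure M (A l) (h l) / m l - \<theta> * e l\<bar> / (\<theta> * (\<theta> * exp (- (\<theta> / \<delta>))))"
      using ev1
    proof eventually_elim
      case (elim l)
      have e: "0 < \<theta> * e l" "\<theta> * (\<theta> * exp (- (\<theta> / \<delta>))) \<le> \<theta> * e l"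
        using exp_bounds(2)[OF k \<delta> elim] assms(3) by (auto simp: e_def intro!: mult_left_mono)
      have "cond_measure M (A l) (h l) / (\<theta> * e l * m l) - 1
          = (cond_measure M (A l) (h l) / m l - \<theta> * e l) / (\<theta> * e l)"
        using e(1) by (auto simp: diff_divide_distrib mult_ac)
      also have "norm \<dots> = \<bar>cond_measure M (A l) (h l) / m l - \<theta> * e l\<bar> / (\<theta> * e l)"
        using e(1) by (simp add: abs_divide)
      also have "\<dots> \<le> \<bar>cond_measure M (A l) (h l) / m l - \<theta> * e l\<bar> / (\<theta> * (\<theta> * exp (- (\<theta> / \<delta>))))"
        using e assms(3) by (intro divide_left_mono) auto
      finally show ?case .
    qed
    from Lim_null_comparison[OF this lim]
    have "(\<lambda>l. cond_measure M (A l) (h l) / (\<theta> * e l * m l)) \<longlonglongrightarrow> 1" by (rule LIM_zero_cancel)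
    then show ?thesis by (simp add: h_def e_def m_def power2_eq_square mult_ac)
  qed

  \<comment> \<open>Removal of the time shift \<open>\<tau>\<close>\<close>
  have part_b: "star_condition M T A Acirc k"
    if \<tau>: "(\<lambda>l. m l * real (\<tau> l)) \<longlonglongrightarrow> 0"
      and b1: "\<forall>k\<in>K_all M A.
         (\<lambda>l. \<bar>cond_measure M (Acirc l) ((T ^^ \<tau> l) -` hit_at M T (A l) (k l) \<inter> space M)
                 - measure M (hit_at M T (A l) (k l))\<bar>) \<in> o(\<lambda>l. measure M (A l))"
      and b2: "\<forall>k\<in>K_all M A.
         (\<lambda>l. cond_measure M (Acirc l)
                  ({x \<in> space M. hitting_time T (A l) x \<le> enat (\<tau> l)}
                   \<inter> ((T ^^ k l) -` A l \<inter> space M))) \<in> o(\<lambda>l. measure M (A l))"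
      and k_all: "k \<in> K_all M A" for \<tau> k
  proof -
    obtain \<delta> where \<delta>: "0 < \<delta>" "\<delta> \<le> 1" and k: "k \<in> K_delta M A \<delta>"
      using k_all by (auto simp: K_all_def)
    \<comment> \<open>\<open>k - \<tau>\<close>, altered at the finitely many \<open>l\<close> where it might leave the class\<close>
    define k' where "k' l = (if m l * real (\<tau> l) \<le> \<delta> / 2 then k l - \<tau> l else k l)" for l
    have k'_pos: "\<tau> l + k' l = k l \<and> 1 \<le> k' l" if "1 \<le> l" "m l * real (\<tau> l) \<le> \<delta> / 2" for l
    proof -
      have "m l * real (\<tau> l) < m l * real (k l)"
        using that k \<delta>(1) by (auto simp: K_delta_def m_def)
      then have "\<tau> l < k l" using m_pos[OF that(1)] by simp
      with that(2) show ?thesis by (simp add: k'_def)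
    qed
    \<comment> \<open>Subtracting \<open>\<tau>\<close> costs at most \<open>\<delta> / 2\<close> in
      the lower bound, so both sequences fit into the class with half the parameter.\<close>
    have k2: "k \<in> K_delta M A (\<delta> / 2)" "k' \<in> K_delta M A (\<delta> / 2)"
    proof -
      have *: "\<delta> / 2 \<le> m l * real (k l)" "m l * real (k l) \<le> 1 / (\<delta> / 2)" if "1 \<le> l" for l
      proof -
        have "\<delta> \<le> m l * real (k l)" "m l * real (k l) \<le> 1 / \<delta>"
          using k that by (auto simp: K_delta_def m_def)
        moreover have "1 / \<delta> \<le> 1 / (\<delta> / 2)" using \<delta> by (simp add: field_simps)
        ultimately show "\<delta> / 2 \<le> m l * real (k l)" "m l * real (k l) \<le> 1 / (\<delta> / 2)" using \<delta> by linarith+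
      qed
      then show "k \<in> K_delta M A (\<delta> / 2)" by (auto simp: K_delta_def m_def)
      have "\<delta> / 2 \<le> m l * real (k' l) \<and> m l * real (k' l) \<le> 1 / (\<delta> / 2)" if "1 \<le> l" for l
      proof (cases "m l * real (\<tau> l) \<le> \<delta> / 2")
        case True
        have "real (k' l) = real (k l) - real (\<tau> l)" using k'_pos[OF that True] by linarith
        then have "m l * real (k' l) = m l * real (k l) - m l * real (\<tau> l)"
          by (simp add: right_diff_distrib)
        moreover have "\<delta> \<le> m l * real (k l)" using k that by (auto simp: K_delta_def m_def)
        moreover have "0 \<le> m l * real (\<tau> l)" using m_pos[OF that] by simp
        ultimately show ?thesis using *[OF that] True by linarith
      qed (use * that in \<open>simp add: k'_def\<close>)
      then show "k' \<in> K_delta M A (\<delta> / 2)" by (auto simp: K_delta_def m_def)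
    qed
    have k'_all: "k' \<in> K_all M A" using k2(2) \<delta> by (auto simp: K_all_def intro!: bexI[of _ "\<delta> / 2"])
    have \<tau>_small: "\<forall>\<^sub>F l in sequentially. m l * real (\<tau> l) \<le> \<delta> / 2"
      using order_tendstoD(2)[OF \<tau>, of "\<delta> / 2"] \<delta> by (auto elim: eventually_mono)
    define h h' P E where "h l = hit_at M T (A l) (k l)" and "h' l = hit_at M T (A l) (k' l)"
      and "P l = (T ^^ \<tau> l) -` hit_at M T (A l) (k' l) \<inter> space M"
      and "E l = {x \<in> space M. hitting_time T (A l) x \<le> enat (\<tau> l)} \<inter> ((T ^^ k l) -` A l \<inter> space M)" for l
    let ?\<nu> = "\<lambda>l. cond_measure M (Acirc l)"
    define e e' where "e l = \<theta> * exp (- \<theta> * m l * real (k l))"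
      and "e' l = \<theta> * exp (- \<theta> * m l * real (k' l))" for l
    \<comment> \<open>Eventually the ratio of \<open>e' l\<close> to \<open>e l\<close> is
      \<open>exp (\<theta> * (m l * real (\<tau> l)))\<close>, which tends to 1, while
      \<open>e l\<close> is at most \<open>\<theta>\<close>.\<close>
    have "(\<lambda>l. e' l - e l) \<longlonglongrightarrow> 0"
    proof -
      have "(\<lambda>l. \<theta> * \<bar>exp (\<theta> * (m l * real (\<tau> l))) - 1\<bar>) \<longlonglongrightarrow> \<theta> * \<bar>exp (\<theta> * 0) - 1\<bar>"
        by (intro tendsto_intros \<tau>)
      then have "(\<lambda>l. \<theta> * \<bar>exp (\<theta> * (m l * real (\<tau> l))) - 1\<bar>) \<longlonglongrightarrow> 0" by simp
      moreover have "\<forall>\<^sub>F l in sequentially. norm (e' l - e l) \<le> \<theta> * \<bar>exp (\<theta> * (m l * real (\<tau> l))) - 1\<bar>"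
        using ev1 \<tau>_small
      proof eventually_elim
        case (elim l)
        have "real (k l) = real (\<tau> l) + real (k' l)" using k'_pos[OF elim] by linarith
        then have "e' l = e l * exp (\<theta> * (m l * real (\<tau> l)))"
          by (simp add: e_def e'_def mult_exp_exp algebra_simps)
        then have "e' l - e l = e l * (exp (\<theta> * (m l * real (\<tau> l))) - 1)"
          by (simp add: algebra_simps)
        moreover have "0 < e l" using assms(3) by (simp add: e_def)
        moreover have "e l \<le> \<theta>" unfolding e_def by (rule exp_bounds(1)[OF k \<delta>(1) elim(1)])
        ultimately show ?case by (simp add: abs_mult mult_right_mono)
      qed
      ultimately show ?thesis by (rule Lim_null_comparison[rotated])
    qed
    from tendsto_diff[OF tendsto_add[OF hit_lim[OF k2(2)] this] hit_lim[OF k2(1)]] \<delta>(1)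
    have "(\<lambda>l. (measure M (h' l) / m l - e' l) + (e' l - e l) - (measure M (h l) / m l - e l)) \<longlonglongrightarrow> 0"
      by (simp add: h_def h'_def e_def e'_def)
    then have "(\<lambda>l. (measure M (h' l) - measure M (h l)) / m l) \<longlonglongrightarrow> 0"
      by (simp add: diff_divide_distrib)
    then have hh': "(\<lambda>l. \<bar>(measure M (h' l) - measure M (h l)) / m l\<bar>) \<longlonglongrightarrow> 0" by (rule tendsto_rabs_zero)
    \<comment> \<open>The three errors of the chain from \<open>?\<nu> l (h l)\<close> through
      \<open>?\<nu> l (P l)\<close> and \<open>measure M (h' l)\<close> to
      \<open>measure M (h l)\<close>. The first is bounded through \<open>b2\<close> for
      \<open>k\<close>, the second through \<open>b1\<close> for \<open>k'\<close>, the third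
      through the local asymptotics of both sequences.\<close>
    have PE: "(\<lambda>l. ?\<nu> l (E l) / m l + \<bar>?\<nu> l (P l) - measure M (h' l)\<bar> / m l
        + \<bar>(measure M (h' l) - measure M (h l)) / m l\<bar>) \<longlonglongrightarrow> 0 + 0 + 0"
      using tendsto_add[OF tendsto_add[OF smalloD_tendsto[OF bspec[OF b2 k_all]]
          smalloD_tendsto[OF bspec[OF b1 k'_all]]] hh']
      unfolding E_def P_def h'_def m_def .
    have bd: "\<forall>\<^sub>F l in sequentially. norm (\<bar>?\<nu> l (h l) - measure M (h l)\<bar> / m l)
       \<le> ?\<nu> l (E l) / m l + \<bar>?\<nu> l (P l) - measure M (h' l)\<bar> / m l
        + \<bar>(measure M (h' l) - measure M (h l)) / m l\<bar>"
      using ev1 \<tau>_small Acirc_pos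
    proof eventually_elim
      case (elim l)
      interpret N: prob_space "uniform_measure M (Acirc l)"
        using elim(3) by (intro prob_space_uniform_measure) (auto simp: emeasure_eq_measure)
      have "\<bar>?\<nu> l (h l) - ?\<nu> l (P l)\<bar> \<le> ?\<nu> l (E l)"
        using N.measure_hit_at_add[of T "A l" "k' l" "\<tau> l"] k'_pos[OF elim(1,2)] A[OF elim(1)]
        by (simp add: h_def P_def E_def)
      then have "\<bar>?\<nu> l (h l) - measure M (h l)\<bar>
          \<le> ?\<nu> l (E l) + \<bar>?\<nu> l (P l) - measure M (h' l)\<bar> + \<bar>measure M (h' l) - measure M (h l)\<bar>"
        by linarith
      from divide_right_mono[OF this, of "m l"] m_pos[OF elim(1)]
      show ?case by (simp add: add_divide_distrib abs_divide)
    qed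
    show ?thesis
      unfolding star_condition_def m_def[symmetric]
    proof (rule smalloI_tendsto)
      show "(\<lambda>l. \<bar>?\<nu> l (hit_at M T (A l) (k l)) - measure M (hit_at M T (A l) (k l))\<bar> / m l) \<longlonglongrightarrow> 0"
        using Lim_null_comparison[OF bd] PE by (simp add: h_def)
    qed (rule m_nz)
  qed
  show ?thesis
  proof (intro conjI impI ballI)
    fix \<delta> :: real assume star: "\<forall>k\<in>K_all M A. star_condition M T A Acirc k" and \<delta>: "\<delta> \<in> {0<..1}"
    show "asymp_equiv_uniformly (K_delta M A \<delta>)
          (\<lambda>k l. cond_measure M (A l) (hit_at M T (A l) (k l)))
          (\<lambda>k l. \<theta>\<^sup>2 * exp (- \<theta> * measure M (A l) * real (k l)) * measure M (A l))"
    proof (rule asymp_equiv_uniformly_K_deltaI)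
      fix k assume k: "k \<in> K_delta M A \<delta>"
      then have "k \<in> K_all M A" using \<delta> by (auto simp: K_all_def)
      with star show "(\<lambda>l. cond_measure M (A l) (hit_at M T (A l) (k l))
          / (\<theta>\<^sup>2 * exp (- \<theta> * measure M (A l) * real (k l)) * measure M (A l))) \<longlonglongrightarrow> 1"
        using k \<delta> by (intro part_a) auto
    qed
  next
    fix k assume "k \<in> K_all M A"
    assume "\<exists>\<tau> :: nat \<Rightarrow> nat.
        (\<lambda>l. measure M (A l) * real (\<tau> l)) \<longlonglongrightarrow> 0 \<and>
        (\<forall>k\<in>K_all M A.
           (\<lambda>l. \<bar>cond_measure M (Acirc l) ((T ^^ \<tau> l) -` hit_at M T (A l) (k l) \<inter> space M)
                 - measure M (hit_at M T (A l) (k l))\<bar>)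
             \<in> o(\<lambda>l. measure M (A l))) \<and>
        (\<forall>k\<in>K_all M A.
           (\<lambda>l. cond_measure M (Acirc l)
                  ({x \<in> space M. hitting_time T (A l) x \<le> enat (\<tau> l)}
                   \<inter> ((T ^^ k l) -` A l \<inter> space M)))
             \<in> o(\<lambda>l. measure M (A l)))"
    then show "star_condition M T A Acirc k"
      by (elim exE conjE) (rule part_b[OF _ _ _ \<open>k \<in> K_all M A\<close>]; simp only: m_def)
  qed
qed

end
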